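(* Let $(M,N)$ be a pair of nonempty, closed, convex subsets of a uniformly convex and uniformly smooth real Banach space $B$, and assume that the set $M_0$ is convex. Let $T: M\to N$ be a proximally weakly suppressive mapping satisfying $T(M_0)\subseteq N_0$, and suppose that $\mathrm{Best}_M^{\phi}(T)$ is nonempty. Let $u_0\in M_0$ be arbitrary, let $a\in[0,1)$ and let $\alpha_n\in[0,a]$ for each $n\in\mathbb{N}=\{1,2,\dots\}$. Consider the sequence $\{u_n\}$ generated by $$u_1=\Pi_{M_0}u_0,\qquad H_1=M_0,$$ and, for each $n\in\mathbb{N}$, $$v_n=J^{-1}\big(\alpha_n Ju_n+(1-\alpha_n)J\Pi_M Tu_n\big),$$ $$H_{n+1}=\{z\in H_n:\ \phi(z,v_n)\le \phi(z,u_n)\},\qquad u_{n+1}=\Pi_{H_{n+1}}u_0 .$$ If $T$ satisfies the $\phi$-proximal property, then $\{u_n\}$ converges strongly (in norm) to $u^*=\Pi_{\mathrm{Best}_M^{\phi}(T)}u_0$.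
   Context: $J:B\to B^*$ is the (single-valued, since $B$ is smooth) normalized duality mapping: $\langle u,Ju\rangle=\|u\|^2=\|Ju\|^2$. Define $\phi(u,v)=\|u\|^2-2\langle u,Jv\rangle+\|v\|^2$ for $u,v\in B$. For a nonempty closed convex $K\subseteq B$ and $u\in B$, $\Pi_K u$ (the generalized projection) is the unique element of $K$ with $\phi(\Pi_K u,u)=\inf_{v\in K}\phi(v,u)$. For nonempty $M,N\subseteq B$: $\mathrm{dist}_\phi(M,N)=\inf\{\phi(u,v):u\in M,v\in N\}$; $M_0=\{u\in M:\phi(u,v)=\mathrm{dist}_\phi(M,N)\text{ for some }v\in N\}$; $N_0=\{v\in N:\phi(u,v)=\mathrm{dist}_\phi(M,N)\text{ for some }u\in M\}$; for $T:M\to N$, $\mathrm{Best}_M^\phi(T)=\{u\in M:\phi(u,Tu)=\mathrm{dist}_\phi(M,N)\}$ is the set of $\phi$-best proximity points. $T:M\to N$ is proximally weakly suppressive if there is a continuous non-decreasing function $\eta:[0,\infty)\to[0,\infty)$, positive on $(0,\infty)$, with $\eta(0)=0$ and $\lim_{t\to\infty}\eta(t)=\infty$, such that for all $u_1,u_2,v_1,v_2\in M$ with $\phi(u_1,Tv_1)=\mathrm{dist}_\phi(M,N)$ and $\phi(u_2,Tv_2)=\mathrm{dist}_\phi(M,N)$ one has $\phi(u_1,u_2)\le\phi(v_1,v_2)-\eta(\phi(v_1,v_2))$. $T:M\to N$ satisfies the $\phi$-proximal property if for each sequence $\{u_n\}$ in $M$ converging weakly to some $u\in M$ with $\lim_{n\to\infty}\phi(u_n,Tu_n)=\mathrm{dist}_\phi(M,N)$,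 one has $\phi(u,Tu)=\mathrm{dist}_\phi(M,N)$. *)

theory Defs
  imports "HOL-Analysis.Analysis"
begin

(* The argument is a type token: the property concerns the norm of the whole space 'a. *)
definition uniformly_convex_space :: "'a::real_normed_vector itself \<Rightarrow> bool" where
  "uniformly_convex_space _ \<longleftrightarrow>
     (\<forall>e>0. \<exists>d>0. \<forall>x y::'a. norm x = 1 \<longrightarrow> norm y = 1 \<longrightarrow> norm (x - y) \<ge> e \<longrightarrow>
        norm ((1/2) *\<^sub>R (x + y)) \<le> 1 - d)"

(* The usual condition rho(t)/t -> 0 (t -> 0+) on the modulus of smoothness
   rho(t) = sup {(norm (x + y) + norm (x - y)) / 2 - 1 | norm x = 1, norm y = t},
   written without the supremum. *)
definition uniformly_smooth_space :: "'a::real_normed_vector itself \<Rightarrow> bool" where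
  "uniformly_smooth_space _ \<longleftrightarrow>
     (\<forall>e>0. \<exists>d>0. \<forall>x y::'a. norm x = 1 \<longrightarrow> norm y \<le> d \<longrightarrow>
        (norm (x + y) + norm (x - y)) / 2 - 1 \<le> e * norm y)"

(* The dual space of 'a is 'a \<Rightarrow>\<^sub>L real with the operator norm.  The description is
   proper when 'a is smooth, which is the only setting in which it is used. *)
definition duality_map :: "'a::real_normed_vector \<Rightarrow> ('a \<Rightarrow>\<^sub>L real)" where
  "duality_map u = (THE f. blinfun_apply f u = (norm u)\<^sup>2 \<and> (norm f)\<^sup>2 = (norm u)\<^sup>2)"

definition phi :: "'a::real_normed_vector \<Rightarrow> 'a \<Rightarrow> real" where
  "phi u v = (norm u)\<^sup>2 - 2 * blinfun_apply (duality_map v) u + (norm v)\<^sup>2"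

definition is_phi_minimizer :: "'a::real_normed_vector set \<Rightarrow> 'a \<Rightarrow> 'a \<Rightarrow> bool" where
  "is_phi_minimizer K u p \<longleftrightarrow> p \<in> K \<and> phi p u = (INF v\<in>K. phi v u)"

(* "The generalized projection of u onto K exists and equals p."  The relational form says
   something about p even when K is not known to be closed. *)
definition is_gen_proj :: "'a::real_normed_vector set \<Rightarrow> 'a \<Rightarrow> 'a \<Rightarrow> bool" where
  "is_gen_proj K u p \<longleftrightarrow>
     is_phi_minimizer K u p \<and> (\<forall>q. is_phi_minimizer K u q \<longrightarrow> q = p)"

definition gen_proj :: "'a::real_normed_vector set \<Rightarrow> 'a \<Rightarrow> 'a" where
  "gen_proj K u = (THE p. is_gen_proj K u p)"

definition dist_phi :: "'a::real_normed_vector set \<Rightarrow> 'a set \<Rightarrow> real" where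
  "dist_phi M N = Inf {phi u v | u v. u \<in> M \<and> v \<in> N}"

(* M_0 and N_0 *)
definition prox_left :: "'a::real_normed_vector set \<Rightarrow> 'a set \<Rightarrow> 'a set" where
  "prox_left M N = {u \<in> M. \<exists>v\<in>N. phi u v = dist_phi M N}"

definition prox_right :: "'a::real_normed_vector set \<Rightarrow> 'a set \<Rightarrow> 'a set" where
  "prox_right M N = {v \<in> N. \<exists>u\<in>M. phi u v = dist_phi M N}"

definition best_prox :: "'a::real_normed_vector set \<Rightarrow> 'a set \<Rightarrow> ('a \<Rightarrow> 'a) \<Rightarrow> 'a set" where
  "best_prox M N T = {u \<in> M. phi u (T u) = dist_phi M N}"

definition proximally_weakly_suppressive ::
    "'a::real_normed_vector set \<Rightarrow> 'a set \<Rightarrow> ('a \<Rightarrow> 'a) \<Rightarrow> bool" where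
  "proximally_weakly_suppressive M N T \<longleftrightarrow>
     (\<exists>\<eta>::real \<Rightarrow> real.
        \<eta> \<in> {0..} \<rightarrow> {0..} \<and> continuous_on {0..} \<eta> \<and> mono_on {0..} \<eta> \<and>
        (\<forall>t>0. \<eta> t > 0) \<and> \<eta> 0 = 0 \<and> filterlim \<eta> at_top at_top \<and>
        (\<forall>u1\<in>M. \<forall>u2\<in>M. \<forall>v1\<in>M. \<forall>v2\<in>M.
           phi u1 (T v1) = dist_phi M N \<longrightarrow> phi u2 (T v2) = dist_phi M N \<longrightarrow>
           phi u1 u2 \<le> phi v1 v2 - \<eta> (phi v1 v2)))"

definition weakly_converges :: "(nat \<Rightarrow> 'a::real_normed_vector) \<Rightarrow> 'a \<Rightarrow> bool" where
  "weakly_converges x l \<longleftrightarrow>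
     (\<forall>f::'a \<Rightarrow>\<^sub>L real. (\<lambda>n. blinfun_apply f (x n)) \<longlonglongrightarrow> blinfun_apply f l)"

definition phi_proximal_property ::
    "'a::real_normed_vector set \<Rightarrow> 'a set \<Rightarrow> ('a \<Rightarrow> 'a) \<Rightarrow> bool" where
  "phi_proximal_property M N T \<longleftrightarrow>
     (\<forall>x l. (\<forall>n. x n \<in> M) \<longrightarrow> l \<in> M \<longrightarrow> weakly_converges x l \<longrightarrow>
        (\<lambda>n. phi (x n) (T (x n))) \<longlonglongrightarrow> dist_phi M N \<longrightarrow>
        phi l (T l) = dist_phi M N)"

end

theory Submission
  imports Defs
begin

text \<open>
  Suppressiveness applied to two best proximity points gives \<open>phi p q = 0\<close>, so there is exactly
  one, \<open>p\<close>, and it lies in every \<open>H n\<close>. The sets \<open>H n\<close> are convex and decreasing, so the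
  three-point inequality for generalized projections makes \<open>u\<close> a Cauchy sequence; its limit \<open>x\<close>
  is also the limit of \<open>v\<close>. Since \<open>phi p (v n) \<le> phi p (u n) - (1 - a) * \<eta> (phi p (u n))\<close>,
  passing to the limit forces \<open>\<eta> (phi p x) = 0\<close>, that is, \<open>x = p\<close>.

  Smoothness makes \<open>y \<mapsto> INF t>0. sq_quot x t y\<close>, the directional derivative of half the squared
  norm at \<open>x\<close>, linear; it is the only functional dominated by all difference quotients, hence the
  value of the duality map at \<open>x\<close>, and no extension theorem of Hahn-Banach type is needed.
  Surjectivity of the duality map comes from uniform convexity: a norming sequence of unit vectors
  for a functional is Cauchy.
\<close>

section \<open>Difference quotients of half the squared norm\<close>

text \<open>Difference quotient of \<open>z \<mapsto> (norm z)\<^sup>2 / 2\<close> at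
  \<open>x\<close> with step \<open>t\<close> in direction \<open>y\<close>. The factor 2 in the
  denominator makes its limit the duality map itself.\<close>

definition sq_quot :: "'a::real_normed_vector \<Rightarrow> real \<Rightarrow> 'a \<Rightarrow> real" where
  "sq_quot x t y = ((norm (x + t *\<^sub>R y))\<^sup>2 - (norm x)\<^sup>2) / (2 * t)"

lemma le_if_le_plus_eps_mult:
  fixes a b c :: real
  assumes "c \<ge> 0" "\<And>t. t > 0 \<Longrightarrow> a \<le> b + t * c"
  shows "a \<le> b"
proof (rule field_le_epsilon)
  fix e :: real assume "e > 0"
  then have "e / (c + 1) > 0" using assms(1) by simp
  then have "a \<le> b + e / (c + 1) * c" by (rule assms(2))
  also have "e / (c + 1) * c \<le> e"
    using \<open>e > 0\<close> assms(1) by (simp add: field_simps)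
  finally show "a \<le> b + e" by simp
qed

text \<open>Forward and backward quotients nearly cancel for small steps. This is the only place
  where the definition of uniform smoothness is unfolded; linearity, uniqueness and continuity below
  all draw on it.\<close>

lemma sq_quot_symmetric_sum:
  fixes x y :: "'a::real_normed_vector"
  assumes smooth: "uniformly_smooth_space TYPE('a)" and "e > 0"
  shows "\<exists>d>0. \<forall>t. 0 < t \<and> t \<le> d \<longrightarrow> sq_quot x t y + sq_quot x t (- y) \<le> e"
proof -
  define L where "L = norm y"
  define R where "R = norm x"
  have L: "L \<ge> 0" and R: "R \<ge> 0" by (auto simp: L_def R_def)
  obtain d where d: "d > 0" and sm: "\<And>t. 0 < t \<Longrightarrow> t \<le> d \<Longrightarrow>
     R * (norm (x + t *\<^sub>R y) + norm (x - t *\<^sub>R y) - 2 * R) \<le> e / 2 * t"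
  proof (cases "x = 0")
    case True
    with \<open>e > 0\<close> show ?thesis by (intro that[of 1]) (auto simp: R_def)
  next
    case False
    then have R0: "R > 0" by (simp add: R_def)
    \<comment> \<open>Chosen so that the smoothness estimate for the rescaled vectors
      \<open>x / R\<close> and \<open>t y / R\<close> becomes \<open>e / 2 * t\<close> once
      multiplied out; \<open>L + 1\<close> in place of \<open>L\<close> covers
      \<open>y = 0\<close>.\<close>
    define e' where "e' = e / (4 * R * (L + 1))"
    have "e' > 0" using R0 L \<open>e > 0\<close> by (simp add: e'_def)
    then obtain d' where d': "d' > 0" and
      sm': "\<And>a b::'a. norm a = 1 \<Longrightarrow> norm b \<le> d' \<Longrightarrow>
        (norm (a + b) + norm (a - b)) / 2 - 1 \<le> e' * norm b"
      using smooth unfolding uniformly_smooth_space_def by blast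
    show ?thesis
    proof (rule that[of "d' * R / (L + 1)"])
      show "d' * R / (L + 1) > 0" using d' R0 L by simp
      fix t :: real assume t: "0 < t" "t \<le> d' * R / (L + 1)"
      let ?a = "(1/R) *\<^sub>R x" and ?b = "(t/R) *\<^sub>R y"
      have nb: "norm ?b = t * L / R" using t R0 by (simp add: L_def)
      have "t * (L + 1) \<le> d' * R" using t L by (simp add: field_simps)
      moreover have "t * L \<le> t * (L + 1)" using t by simp
      ultimately have "norm ?b \<le> d'" unfolding nb using R0 by (simp add: field_simps)
      moreover have "norm ?a = 1" using R0 by (simp add: R_def)
      ultimately have s: "(norm (?a + ?b) + norm (?a - ?b)) / 2 - 1 \<le> e' * (t * L / R)"
        using sm' nb by metis
      have "?a + ?b = (1/R) *\<^sub>R (x + t *\<^sub>R y)" "?a - ?b = (1/R) *\<^sub>R (x - t *\<^sub>R y)"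
        by (simp_all add: algebra_simps)
      then have ab: "norm (?a + ?b) = norm (x + t *\<^sub>R y) / R" "norm (?a - ?b) = norm (x - t *\<^sub>R y) / R"
        using R0 by simp_all
      have "R * (norm (x + t *\<^sub>R y) + norm (x - t *\<^sub>R y) - 2 * R) \<le> R * (2 * (e' * t * L))"
        using s R0 unfolding ab by (simp add: field_simps)
      also have "\<dots> = e / 2 * t * (L / (L + 1))"
        using R0 L unfolding e'_def by (simp add: divide_simps)
      also have "\<dots> \<le> e / 2 * t * 1"
        using L t \<open>e > 0\<close> by (intro mult_left_mono) auto
      finally show "R * (norm (x + t *\<^sub>R y) + norm (x - t *\<^sub>R y) - 2 * R) \<le> e / 2 * t" by simp
    qed
  qed
  \<comment> \<open>The second bound keeps the quadratic error \<open>2 * (t * L)\<^sup>2\<close>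
    below \<open>e * t\<close>; the other \<open>e * t\<close> comes from \<open>sm\<close>.\<close>
  define c where "c = min d (e / (2 * L\<^sup>2 + 1))"
  have pos: "2 * L\<^sup>2 + 1 > 0" by (simp add: add_nonneg_pos)
  have "c > 0" using d \<open>e > 0\<close> pos by (simp add: c_def)
  moreover have "sq_quot x t y + sq_quot x t (- y) \<le> e" if t: "0 < t" "t \<le> c" for t
  proof -
    let ?A = "norm (x + t *\<^sub>R y)" and ?B = "norm (x - t *\<^sub>R y)"
    have td: "t \<le> d" and "t \<le> e / (2 * L\<^sup>2 + 1)" using t by (auto simp: c_def)
    then have "t * (2 * L\<^sup>2 + 1) \<le> e" using pos by (simp add: field_simps)
    then have tL: "t * (t * (2 * L\<^sup>2 + 1)) \<le> t * e" using t by (intro mult_left_mono) auto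
    have "\<bar>?A - R\<bar> \<le> norm (x + t *\<^sub>R y - x)" unfolding R_def by (rule norm_triangle_ineq3)
    then have A: "\<bar>?A - R\<bar> \<le> t * L" using t by (simp add: L_def)
    have "\<bar>?B - R\<bar> \<le> norm (x - t *\<^sub>R y - x)" unfolding R_def by (rule norm_triangle_ineq3)
    then have B: "\<bar>?B - R\<bar> \<le> t * L" using t by (simp add: L_def)
    have A2: "(?A - R)\<^sup>2 \<le> (t * L)\<^sup>2" and B2: "(?B - R)\<^sup>2 \<le> (t * L)\<^sup>2"
      using A B abs_le_square_iff[of "?A - R" "t * L"] abs_le_square_iff[of "?B - R" "t * L"] L t
      by auto
    \<comment> \<open>Completing squares separates terms of order \<open>t\<^sup>2\<close>,
      controlled by the triangle inequality, from the term that smoothness controls.\<close>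
    have "?A\<^sup>2 - R\<^sup>2 + (?B\<^sup>2 - R\<^sup>2) = (?A - R)\<^sup>2 + (?B - R)\<^sup>2 + 2 * (R * (?A + ?B - 2 * R))"
      by (simp add: power2_eq_square algebra_simps)
    also have "\<dots> \<le> 2 * (t * L)\<^sup>2 + e * t"
      using A2 B2 sm[OF t(1) td] by linarith
    also have "2 * (t * L)\<^sup>2 = t * (t * (2 * L\<^sup>2 + 1)) - t * t"
      by (simp add: power2_eq_square algebra_simps)
    also have "t * (t * (2 * L\<^sup>2 + 1)) - t * t + e * t \<le> t * e - 0 + e * t"
      using tL by (intro add_right_mono diff_mono) auto
    also have "\<dots> = 2 * t * e" by simp
    finally have "(?A\<^sup>2 - R\<^sup>2 + (?B\<^sup>2 - R\<^sup>2)) / (2 * t) \<le> e"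
      using t by (simp add: field_simps)
    then show ?thesis
      by (simp only: sq_quot_def R_def add_divide_distrib scaleR_minus_right add_uminus_conv_diff)
  qed
  ultimately show ?thesis by blast
qed

lemma sq_quot_scaleR:
  assumes "c > 0"
  shows "sq_quot x (t / c) (c *\<^sub>R y) = c * sq_quot x t y"
  using assms by (simp add: sq_quot_def)

text \<open>Keeps the infimum over \<open>t\<close> finite, and later bounds the resulting
  functional by \<open>norm x\<close>.\<close>

lemma sq_quot_lower:
  assumes "t > 0"
  shows "- (norm x * norm y) \<le> sq_quot x t y"
proof -
  have n: "norm x - t * norm y \<le> norm (x + t *\<^sub>R y)"
    using norm_diff_ineq[of x "t *\<^sub>R y"] assms by simp
  \<comment> \<open>Squaring \<open>n\<close> is legitimate only when its left side is nonnegative;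
    otherwise the left side of the claim is itself at most 0.\<close>
  have "(norm x)\<^sup>2 - 2 * t * (norm x * norm y) \<le> (norm (x + t *\<^sub>R y))\<^sup>2"
  proof (cases "norm x \<ge> t * norm y")
    case True
    then have "(norm x - t * norm y)\<^sup>2 \<le> (norm (x + t *\<^sub>R y))\<^sup>2"
      using n by (intro power_mono) auto
    moreover have "(norm x - t * norm y)\<^sup>2 = (norm x)\<^sup>2 - 2 * t * (norm x * norm y) + (t * norm y)\<^sup>2"
      by (simp add: power2_eq_square algebra_simps)
    ultimately show ?thesis by (smt (verit) zero_le_power2)
  next
    case False
    then have "norm x * norm x \<le> norm x * (t * norm y)" by (intro mult_left_mono) auto
    moreover have "0 \<le> norm x * (t * norm y)" using assms by simp
    ultimately have "(norm x)\<^sup>2 - 2 * t * (norm x * norm y) \<le> 0"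
      by (simp add: power2_eq_square algebra_simps)
    also have "\<dots> \<le> (norm (x + t *\<^sub>R y))\<^sup>2" by simp
    finally show ?thesis .
  qed
  then show ?thesis using assms by (simp add: sq_quot_def field_simps)
qed

lemma power2_convex_comb:
  fixes a b l :: real
  assumes "0 \<le> l" "l \<le> 1"
  shows "(l * a + (1 - l) * b)\<^sup>2 \<le> l * a\<^sup>2 + (1 - l) * b\<^sup>2"
proof -
  have "l * a\<^sup>2 + (1 - l) * b\<^sup>2 - (l * a + (1 - l) * b)\<^sup>2 = l * (1 - l) * (a - b)\<^sup>2"
    by (simp add: power2_eq_square algebra_simps)
  also have "\<dots> \<ge> 0" using assms by simp
  finally show ?thesis by simp
qed

lemma norm_power2_convex_comb:
  fixes a b :: "'b::real_normed_vector"
  assumes "0 \<le> l" "l \<le> 1"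
  shows "(norm (l *\<^sub>R a + (1 - l) *\<^sub>R b))\<^sup>2 \<le> l * (norm a)\<^sup>2 + (1 - l) * (norm b)\<^sup>2"
proof -
  have "norm (l *\<^sub>R a + (1 - l) *\<^sub>R b) \<le> l * norm a + (1 - l) * norm b"
    using norm_triangle_ineq[of "l *\<^sub>R a" "(1 - l) *\<^sub>R b"] assms by simp
  then have "(norm (l *\<^sub>R a + (1 - l) *\<^sub>R b))\<^sup>2 \<le> (l * norm a + (1 - l) * norm b)\<^sup>2"
    by (intro power_mono) auto
  with power2_convex_comb[OF assms, of "norm a" "norm b"] show ?thesis by linarith
qed

text \<open>With \<open>r = s * t / (s + t)\<close>, the point \<open>x + r (y + z)\<close> is the
  convex combination of \<open>x + s y\<close> and \<open>x + t z\<close> with weights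
  \<open>t / (s + t)\<close> and \<open>s / (s + t)\<close>, and the squared norm is convex.
  Independent steps \<open>s\<close> and \<open>t\<close> make the infimum over steps
  subadditive.\<close>

lemma sq_quot_add:
  assumes "s > 0" "t > 0"
  shows "sq_quot x (s * t / (s + t)) (y + z) \<le> sq_quot x s y + sq_quot x t z"
proof -
  define l where "l = t / (s + t)"
  have l: "0 \<le> l" "l \<le> 1" "1 - l = s / (s + t)" using assms by (auto simp: l_def field_simps)
  have r: "s * t / (s + t) = l * s" "l * s = (1 - l) * t" unfolding l(3) by (simp_all add: l_def)
  have l0: "l > 0" "1 - l > 0" using assms unfolding l(3) by (auto simp: l_def)
  have "x + (l * s) *\<^sub>R (y + z) = x + (l * s) *\<^sub>R y + ((1 - l) * t) *\<^sub>R z"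
    unfolding r(2)[symmetric] by (simp add: scaleR_add_right)
  also have "\<dots> = l *\<^sub>R (x + s *\<^sub>R y) + (1 - l) *\<^sub>R (x + t *\<^sub>R z)"
    by (simp add: algebra_simps)
  finally have "(norm (x + (l * s) *\<^sub>R (y + z)))\<^sup>2
      \<le> l * (norm (x + s *\<^sub>R y))\<^sup>2 + (1 - l) * (norm (x + t *\<^sub>R z))\<^sup>2"
    using norm_power2_convex_comb[OF l(1,2)] by simp
  then have "(norm (x + (l * s) *\<^sub>R (y + z)))\<^sup>2 - (norm x)\<^sup>2
      \<le> l * ((norm (x + s *\<^sub>R y))\<^sup>2 - (norm x)\<^sup>2) + (1 - l) * ((norm (x + t *\<^sub>R z))\<^sup>2 - (norm x)\<^sup>2)"
    by (simp add: algebra_simps)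
  then have "sq_quot x (l * s) (y + z)
      \<le> (l * ((norm (x + s *\<^sub>R y))\<^sup>2 - (norm x)\<^sup>2) + (1 - l) * ((norm (x + t *\<^sub>R z))\<^sup>2 - (norm x)\<^sup>2)) / (2 * (l * s))"
    unfolding sq_quot_def using l0 assms by (intro divide_right_mono) auto
  also have "\<dots> = l * ((norm (x + s *\<^sub>R y))\<^sup>2 - (norm x)\<^sup>2) / (2 * (l * s))
       + (1 - l) * ((norm (x + t *\<^sub>R z))\<^sup>2 - (norm x)\<^sup>2) / (2 * ((1 - l) * t))"
    unfolding r(2)[symmetric] by (simp add: add_divide_distrib)
  also have "\<dots> = sq_quot x s y + sq_quot x t z"
    unfolding sq_quot_def using l0 by simp
  finally show ?thesis unfolding r(1) .
qed

section \<open>The duality map as derivative of half the squared norm\<close>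

text \<open>The right side says that \<open>f\<close> is a subgradient of half the squared norm at
  \<open>x\<close>. Forwards, this is the arithmetic-geometric mean inequality. Backwards, small
  \<open>t\<close> in the directions \<open>y\<close> and \<open>- y\<close> gives
  \<open>norm f \<le> norm x\<close>, and the direction \<open>- x\<close> gives the lower bound on
  \<open>f x\<close>.\<close>

lemma subgradient_iff:
  fixes f :: "'a::real_normed_vector \<Rightarrow>\<^sub>L real"
  shows "(blinfun_apply f x = (norm x)\<^sup>2 \<and> (norm f)\<^sup>2 = (norm x)\<^sup>2) \<longleftrightarrow>
         (\<forall>y t. t > 0 \<longrightarrow> blinfun_apply f y \<le> sq_quot x t y)"
proof
  assume a: "blinfun_apply f x = (norm x)\<^sup>2 \<and> (norm f)\<^sup>2 = (norm x)\<^sup>2"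
  then have nf: "norm f = norm x" by simp
  show "\<forall>y t. t > 0 \<longrightarrow> blinfun_apply f y \<le> sq_quot x t y"
  proof (intro allI impI)
    fix y :: 'a and t :: real assume t: "t > 0"
    have "blinfun_apply f (x + t *\<^sub>R y) \<le> norm x * norm (x + t *\<^sub>R y)"
      using norm_blinfun[of f "x + t *\<^sub>R y"] nf by simp
    also have "\<dots> \<le> ((norm x)\<^sup>2 + (norm (x + t *\<^sub>R y))\<^sup>2) / 2"
      using sum_squares_bound[of "norm x" "norm (x + t *\<^sub>R y)"] by simp
    finally have "t * blinfun_apply f y \<le> ((norm (x + t *\<^sub>R y))\<^sup>2 - (norm x)\<^sup>2) / 2"
      using a by (simp add: blinfun.add_right blinfun.scaleR_right field_simps)
    then show "blinfun_apply f y \<le> sq_quot x t y"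
      using t by (simp add: sq_quot_def field_simps)
  qed
next
  assume "\<forall>y t. t > 0 \<longrightarrow> blinfun_apply f y \<le> sq_quot x t y"
  then have sg: "\<And>y t. t > 0 \<Longrightarrow> blinfun_apply f y \<le> sq_quot x t y" by blast
  have upper: "blinfun_apply f y \<le> norm x * norm y" for y
  proof (rule le_if_le_plus_eps_mult[where c = "(norm y)\<^sup>2 / 2"])
    fix t :: real assume t: "t > 0"
    have "norm (x + t *\<^sub>R y) \<le> norm x + t * norm y"
      using norm_triangle_ineq[of x "t *\<^sub>R y"] t by simp
    then have "(norm (x + t *\<^sub>R y))\<^sup>2 \<le> (norm x + t * norm y)\<^sup>2" by (intro power_mono) auto
    then have "sq_quot x t y \<le> ((norm x + t * norm y)\<^sup>2 - (norm x)\<^sup>2) / (2 * t)"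
      unfolding sq_quot_def using t by (intro divide_right_mono) auto
    also have "\<dots> = norm x * norm y + t * ((norm y)\<^sup>2 / 2)"
      using t by (simp add: field_simps power2_eq_square)
    finally show "blinfun_apply f y \<le> norm x * norm y + t * ((norm y)\<^sup>2 / 2)"
      using sg[OF t, of y] by linarith
  qed simp
  have "norm f \<le> norm x"
  proof (rule norm_blinfun_bound)
    fix y show "norm (blinfun_apply f y) \<le> norm x * norm y"
      using upper[of y] upper[of "- y"] by (simp add: blinfun.minus_right abs_le_iff)
  qed simp
  have "- blinfun_apply f x \<le> - (norm x)\<^sup>2"
  proof (rule le_if_le_plus_eps_mult[where c = "(norm x)\<^sup>2 / 2"])
    fix t :: real assume t: "t > 0"
    have "x + t *\<^sub>R (- x) = (1 - t) *\<^sub>R x" by (simp add: algebra_simps)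
    then have "sq_quot x t (- x) = ((1 - t)\<^sup>2 * (norm x)\<^sup>2 - (norm x)\<^sup>2) / (2 * t)"
      by (simp only: sq_quot_def norm_scaleR power_mult_distrib power2_abs)
    also have "\<dots> = - (norm x)\<^sup>2 + t * ((norm x)\<^sup>2 / 2)"
      using t by (simp add: field_simps power2_eq_square)
    finally show "- blinfun_apply f x \<le> - (norm x)\<^sup>2 + t * ((norm x)\<^sup>2 / 2)"
      using sg[OF t, of "- x"] by (simp add: blinfun.minus_right)
  qed simp
  then have fx: "blinfun_apply f x = (norm x)\<^sup>2"
    using upper[of x] by (simp add: power2_eq_square)
  have "norm x \<le> norm f"
  proof (cases "x = 0")
    case False
    have "norm x * norm x \<le> norm f * norm x"
      using norm_blinfun[of f x] fx by (simp add: power2_eq_square)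
    with False show ?thesis by simp
  qed simp
  with \<open>norm f \<le> norm x\<close> fx show "blinfun_apply f x = (norm x)\<^sup>2 \<and> (norm f)\<^sup>2 = (norm x)\<^sup>2"
    by simp
qed

text \<open>The infimum \<open>p\<close> of the quotients is subadditive and positively homogeneous
  by convexity; smoothness makes it odd, hence linear.\<close>

lemma subgradient_exists:
  fixes x :: "'a::real_normed_vector"
  assumes smooth: "uniformly_smooth_space TYPE('a)"
  shows "\<exists>f::'a \<Rightarrow>\<^sub>L real. \<forall>y t. t > 0 \<longrightarrow> blinfun_apply f y \<le> sq_quot x t y"
proof -
  define p where "p y = (INF t\<in>{0<..}. sq_quot x t y)" for y
  have le: "p y \<le> sq_quot x t y" if "t > 0" for t y
    unfolding p_def using that sq_quot_lower[of _ x y]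
    by (intro cINF_lower bdd_belowI2[where m = "- (norm x * norm y)"]) auto
  have ge: "c \<le> p y" if "\<And>t. t > 0 \<Longrightarrow> c \<le> sq_quot x t y" for c y
    unfolding p_def using that by (intro cINF_greatest) auto
  have sub: "p (y + z) \<le> p y + p z" for y z
  proof -
    \<comment> \<open>The two infima are taken one after the other: over \<open>t\<close> for a
      fixed \<open>s\<close>, then over \<open>s\<close>.\<close>
    have "p (y + z) - sq_quot x s y \<le> p z" if "s > 0" for s
    proof (rule ge)
      fix t :: real assume "t > 0"
      then have "p (y + z) \<le> sq_quot x (s * t / (s + t)) (y + z)" using that by (intro le) auto
      with sq_quot_add[OF that \<open>t > 0\<close>, of x y z]
      show "p (y + z) - sq_quot x s y \<le> sq_quot x t z" by linarith
    qed
    then have "p (y + z) - p z \<le> p y" by (intro ge) (simp add: algebra_simps)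
    then show ?thesis by simp
  qed
  have p0: "p 0 = 0" by (simp add: p_def sq_quot_def)
  have neg: "p (- y) = - p y" for y
  proof -
    have "p y + p (- y) \<le> 0"
    proof (rule field_le_epsilon)
      fix e :: real assume "e > 0"
      then obtain t where "t > 0" "sq_quot x t y + sq_quot x t (- y) \<le> e"
        using sq_quot_symmetric_sum[OF smooth] by (metis order_refl)
      with le[of t y] le[of t "- y"] show "p y + p (- y) \<le> 0 + e" by linarith
    qed
    with sub[of y "- y"] p0 show ?thesis by simp
  qed
  have add: "p (y + z) = p y + p z" for y z
    using sub[of y z] sub[of "y + z" "- z"] neg[of z] by simp
  have scale_le: "p (c *\<^sub>R y) \<le> c * p y" if "c > 0" for c y
  proof -
    have "p (c *\<^sub>R y) / c \<le> p y"
    proof (rule ge)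
      fix t :: real assume "t > 0"
      then have "p (c *\<^sub>R y) \<le> c * sq_quot x t y"
        using le[of "t / c" "c *\<^sub>R y"] that unfolding sq_quot_scaleR[OF that] by simp
      then show "p (c *\<^sub>R y) / c \<le> sq_quot x t y" using that by (simp add: field_simps)
    qed
    then show ?thesis using that by (simp add: field_simps)
  qed
  have scale_pos: "p (c *\<^sub>R y) = c * p y" if "c > 0" for c y
  proof (rule antisym[OF scale_le[OF that]])
    show "c * p y \<le> p (c *\<^sub>R y)"
      using scale_le[of "1 / c" "c *\<^sub>R y"] that by (simp add: field_simps)
  qed
  have scale: "p (c *\<^sub>R y) = c * p y" for c y
  proof -
    consider "c > 0" | "c = 0" | "c < 0" by linarith
    then show ?thesis
    proof cases
      case 3
      then show ?thesis using scale_pos[of "- c" y] neg[of "c *\<^sub>R y"] by simp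
    qed (use scale_pos p0 in auto)
  qed
  have bd: "\<bar>p y\<bar> \<le> norm y * norm x" for y
  proof -
    have "- (norm x * norm y) \<le> p y" "- (norm x * norm (- y)) \<le> p (- y)"
      by (intro ge sq_quot_lower; assumption)+
    then show ?thesis using neg[of y] by (simp add: algebra_simps abs_le_iff)
  qed
  have "bounded_linear p"
    by (rule bounded_linear_intro[where K = "norm x"]) (use add scale bd in auto)
  then have "blinfun_apply (Blinfun p) = p" by (rule bounded_linear_Blinfun_apply)
  then show ?thesis using le by (intro exI[of _ "Blinfun p"]) simp
qed

text \<open>Bounding one functional at \<open>y\<close> and the other at \<open>- y\<close> puts
  their difference at \<open>y\<close> below the symmetric sum, which is arbitrarily small.\<close>

lemma subgradient_unique:
  fixes f g :: "'a::real_normed_vector \<Rightarrow>\<^sub>L real"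
  assumes smooth: "uniformly_smooth_space TYPE('a)"
    and f: "\<And>y t. t > 0 \<Longrightarrow> blinfun_apply f y \<le> sq_quot x t y"
    and g: "\<And>y t. t > 0 \<Longrightarrow> blinfun_apply g y \<le> sq_quot x t y"
  shows "f = g"
proof -
  have *: "blinfun_apply h y \<le> blinfun_apply k y"
    if h: "\<And>y t. t > 0 \<Longrightarrow> blinfun_apply h y \<le> sq_quot x t y"
    and k: "\<And>y t. t > 0 \<Longrightarrow> blinfun_apply k y \<le> sq_quot x t y"
    for h k :: "'a \<Rightarrow>\<^sub>L real" and y
  proof (rule field_le_epsilon)
    fix e :: real assume "e > 0"
    then obtain t where "t > 0" "sq_quot x t y + sq_quot x t (- y) \<le> e"
      using sq_quot_symmetric_sum[OF smooth] by (metis order_refl)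
    with h[of t y] k[of t "- y"] show "blinfun_apply h y \<le> blinfun_apply k y + e"
      by (simp add: blinfun.minus_right)
  qed
  show ?thesis by (rule blinfun_eqI) (intro antisym *; fact)
qed

text \<open>Under smoothness the definite description is proper, because its two conditions
  characterise the unique subgradient.\<close>

lemma duality_map_eqI:
  fixes f :: "'a::real_normed_vector \<Rightarrow>\<^sub>L real"
  assumes smooth: "uniformly_smooth_space TYPE('a)"
    and "blinfun_apply f x = (norm x)\<^sup>2" "norm f = norm x"
  shows "duality_map x = f"
  unfolding duality_map_def
proof (rule the_equality)
  show f: "blinfun_apply f x = (norm x)\<^sup>2 \<and> (norm f)\<^sup>2 = (norm x)\<^sup>2" using assms by simp
  fix g :: "'a \<Rightarrow>\<^sub>L real" assume "blinfun_apply g x = (norm x)\<^sup>2 \<and> (norm g)\<^sup>2 = (norm x)\<^sup>2"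
  then show "g = f" using f unfolding subgradient_iff by (intro subgradient_unique[OF smooth]) auto
qed

lemma duality_map:
  fixes x :: "'a::real_normed_vector"
  assumes smooth: "uniformly_smooth_space TYPE('a)"
  shows duality_map_self: "blinfun_apply (duality_map x) x = (norm x)\<^sup>2"
    and norm_duality_map: "norm (duality_map x) = norm x"
    and duality_map_le_sq_quot: "t > 0 \<Longrightarrow> blinfun_apply (duality_map x) y \<le> sq_quot x t y"
proof -
  obtain f :: "'a \<Rightarrow>\<^sub>L real" where sg: "\<forall>y t. t > 0 \<longrightarrow> blinfun_apply f y \<le> sq_quot x t y"
    using subgradient_exists[OF smooth] by blast
  then have f: "blinfun_apply f x = (norm x)\<^sup>2" "norm f = norm x"
    using subgradient_iff[of f x] by auto
  have "duality_map x = f" by (rule duality_map_eqI[OF smooth f])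
  with f sg show "blinfun_apply (duality_map x) x = (norm x)\<^sup>2" "norm (duality_map x) = norm x"
    "t > 0 \<Longrightarrow> blinfun_apply (duality_map x) y \<le> sq_quot x t y" by auto
qed

text \<open>Reverse of \<open>duality_map_le_sq_quot\<close> up to \<open>e\<close>: the quotient
  towards \<open>- y\<close> is bounded below, so the symmetric sum bounds the one towards
  \<open>y\<close> above. Together they give directional differentiability.\<close>

lemma sq_quot_le_duality_map:
  fixes x y :: "'a::real_normed_vector"
  assumes smooth: "uniformly_smooth_space TYPE('a)" and "e > 0"
  shows "\<exists>d>0. \<forall>t. 0 < t \<and> t \<le> d \<longrightarrow> sq_quot x t y \<le> blinfun_apply (duality_map x) y + e"
proof -
  obtain d where "d > 0" and
    d: "\<And>t. 0 < t \<Longrightarrow> t \<le> d \<Longrightarrow> sq_quot x t y + sq_quot x t (- y) \<le> e"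
    using sq_quot_symmetric_sum[OF assms] by blast
  have "sq_quot x t y \<le> blinfun_apply (duality_map x) y + e" if "0 < t" "t \<le> d" for t
    using d[OF that] duality_map_le_sq_quot[OF smooth that(1), of x "- y"]
    by (simp add: blinfun.minus_right)
  with \<open>d > 0\<close> show ?thesis by blast
qed

text \<open>For a fixed step the quotient is continuous in its base point and dominates the duality
  map. A step that is good at \<open>x\<close> gives the upper estimate, and \<open>- y\<close> the
  lower one. Pointwise convergence suffices, since \<open>phi z\<close> evaluates the functional at
  the fixed \<open>z\<close>.\<close>

lemma duality_map_weak_star_continuous:
  fixes x :: "'a::real_normed_vector"
  assumes smooth: "uniformly_smooth_space TYPE('a)" and lim: "X \<longlonglongrightarrow> x"
  shows "(\<lambda>n. blinfun_apply (duality_map (X n)) y) \<longlonglongrightarrow> blinfun_apply (duality_map x) y"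
proof -
  have up: "\<forall>\<^sub>F n in sequentially. blinfun_apply (duality_map (X n)) y < blinfun_apply (duality_map x) y + e"
    if "e > 0" for e :: real and y
  proof -
    obtain t where t: "t > 0" "sq_quot x t y \<le> blinfun_apply (duality_map x) y + e / 2"
      using sq_quot_le_duality_map[OF smooth, of "e / 2" x y] \<open>e > 0\<close> by auto
    have "(\<lambda>n. sq_quot (X n) t y) \<longlonglongrightarrow> sq_quot x t y"
      unfolding sq_quot_def using t by (intro tendsto_intros lim) auto
    then have "\<forall>\<^sub>F n in sequentially. sq_quot (X n) t y < blinfun_apply (duality_map x) y + e"
      using t \<open>e > 0\<close> by (intro order_tendstoD(2)[where y = "sq_quot x t y"]) auto
    then show ?thesis
      by eventually_elim (use duality_map_le_sq_quot[OF smooth t(1)] le_less_trans in blast)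
  qed
  show ?thesis
  proof (rule tendstoI)
    fix e :: real assume "e > 0"
    from up[OF this, of y] up[OF this, of "- y"]
    show "\<forall>\<^sub>F n in sequentially.
        dist (blinfun_apply (duality_map (X n)) y) (blinfun_apply (duality_map x) y) < e"
      by eventually_elim (auto simp: dist_real_def blinfun.minus_right abs_less_iff)
  qed
qed

section \<open>Surjectivity of the duality map\<close>

lemma unit_vector_almost_norming:
  fixes f :: "'a::real_normed_vector \<Rightarrow>\<^sub>L real"
  assumes "f \<noteq> 0" "d > 0"
  shows "\<exists>x. norm x = 1 \<and> norm f * (1 - d) \<le> blinfun_apply f x"
proof (rule ccontr)
  assume contra: "\<nexists>x. norm x = 1 \<and> norm f * (1 - d) \<le> blinfun_apply f x"
  \<comment> \<open>\<open>norm_blinfun_bound\<close> asks for a nonnegative constant, while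
    \<open>d\<close> may exceed 1.\<close>
  define b where "b = max 0 (norm f * (1 - d))"
  have le: "blinfun_apply f y \<le> b * norm y" for y
  proof (cases "y = 0")
    case False
    then have "norm ((1 / norm y) *\<^sub>R y) = 1" by simp
    with contra have "blinfun_apply f ((1 / norm y) *\<^sub>R y) \<le> norm f * (1 - d)"
      by (meson linear)
    also have "\<dots> \<le> b" by (simp add: b_def)
    finally show ?thesis using False by (simp add: blinfun.scaleR_right field_simps)
  qed simp
  have "norm f \<le> b"
  proof (rule norm_blinfun_bound)
    show "norm (blinfun_apply f y) \<le> b * norm y" for y
      using le[of y] le[of "- y"] by (simp add: blinfun.minus_right abs_le_iff)
  qed (simp add: b_def)
  moreover have "b < norm f" using assms by (simp add: b_def)
  ultimately show False by simp
qed

text \<open>If two late terms of a norming sequence were \<open>e\<close> apart, their midpoint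
  would have norm at most \<open>1 - d\<close>, although \<open>f\<close> exceeds
  \<open>norm f * (1 - d)\<close> there.\<close>

lemma norming_vector_exists:
  fixes f :: "'a::banach \<Rightarrow>\<^sub>L real"
  assumes uc: "uniformly_convex_space TYPE('a)" and "f \<noteq> 0"
  shows "\<exists>x. norm x = 1 \<and> blinfun_apply f x = norm f"
proof -
  define L where "L = norm f"
  have "L > 0" using assms by (simp add: L_def)
  have "\<forall>n. \<exists>x. norm x = 1 \<and> L * (1 - 1 / real (Suc n)) \<le> blinfun_apply f x"
    unfolding L_def using unit_vector_almost_norming[OF \<open>f \<noteq> 0\<close>] by simp
  then obtain X where X: "\<And>n. norm (X n) = 1"
    and fX: "\<And>n. L * (1 - 1 / real (Suc n)) \<le> blinfun_apply f (X n)" by metis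
  have "Cauchy X"
  proof (rule CauchyI)
    fix e :: real assume "e > 0"
    then obtain d where "d > 0" and
      d: "\<And>x y::'a. norm x = 1 \<Longrightarrow> norm y = 1 \<Longrightarrow> norm (x - y) \<ge> e \<Longrightarrow>
            norm ((1/2) *\<^sub>R (x + y)) \<le> 1 - d"
      using uc unfolding uniformly_convex_space_def by blast
    obtain k where k: "1 / real (Suc k) < d" using nat_approx_posE[OF \<open>d > 0\<close>] by metis
    have "norm (X m - X n) < e" if "m \<ge> k" "n \<ge> k" for m n
    proof (rule ccontr)
      assume "\<not> norm (X m - X n) < e"
      then have half: "norm ((1/2) *\<^sub>R (X m + X n)) \<le> 1 - d" by (intro d X) simp
      have big: "L * (1 - d) < blinfun_apply f (X j)" if "j \<ge> k" for j
      proof -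
        have "1 / real (Suc j) \<le> 1 / real (Suc k)" using that by (intro divide_left_mono) auto
        then have "L * (1 - d) < L * (1 - 1 / real (Suc j))" using k \<open>L > 0\<close> by simp
        with fX[of j] show ?thesis by simp
      qed
      have "L * (1 - d) < blinfun_apply f ((1/2) *\<^sub>R (X m + X n))"
        using big[OF that(1)] big[OF that(2)] by (simp add: blinfun.scaleR_right blinfun.add_right)
      also have "\<dots> \<le> L * norm ((1/2) *\<^sub>R (X m + X n))"
        unfolding L_def using norm_blinfun[of f "(1/2) *\<^sub>R (X m + X n)"] by simp
      also have "\<dots> \<le> L * (1 - d)" using half \<open>L > 0\<close> by (intro mult_left_mono) auto
      finally show False by simp
    qed
    then show "\<exists>k. \<forall>m\<ge>k. \<forall>n\<ge>k. norm (X m - X n) < e" by blast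
  qed
  then obtain x where x: "X \<longlonglongrightarrow> x" using Cauchy_convergent_iff convergent_def by blast
  have nx: "norm x = 1"
    using LIMSEQ_unique[OF tendsto_norm[OF x]] X by simp
  have "(\<lambda>n. L * (1 - 1 / real (Suc n))) \<longlonglongrightarrow> L * (1 - 0)"
    by (intro tendsto_intros LIMSEQ_Suc[OF lim_1_over_n])
  moreover have "(\<lambda>n. blinfun_apply f (X n)) \<longlonglongrightarrow> blinfun_apply f x"
    by (intro tendsto_intros x)
  ultimately have "L * (1 - 0) \<le> blinfun_apply f x" using fX by (intro LIMSEQ_le) auto
  moreover have "blinfun_apply f x \<le> L" using norm_blinfun[of f x] nx by (simp add: L_def)
  ultimately show ?thesis using nx by (auto simp: L_def)
qed

text \<open>Makes \<open>inv duality_map\<close> a genuine right inverse, so that the functional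
  defining \<open>v n\<close> really is the image of \<open>v n\<close>.\<close>

lemma surj_duality_map:
  assumes uc: "uniformly_convex_space TYPE('a::banach)"
    and smooth: "uniformly_smooth_space TYPE('a)"
  shows "surj (duality_map :: 'a \<Rightarrow> ('a \<Rightarrow>\<^sub>L real))"
proof -
  have "\<exists>x. duality_map x = f" for f :: "'a \<Rightarrow>\<^sub>L real"
  proof (cases "f = 0")
    case True
    then show ?thesis by (intro exI[of _ 0] duality_map_eqI[OF smooth]) auto
  next
    case False
    then obtain x where "norm x = 1" "blinfun_apply f x = norm f"
      using norming_vector_exists[OF uc] by blast
    then show ?thesis
      by (intro exI[of _ "norm f *\<^sub>R x"] duality_map_eqI[OF smooth])
        (auto simp: blinfun.scaleR_right power2_eq_square)
  qed
  then show ?thesis unfolding surj_def by metis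
qed

section \<open>Convexity, definiteness and continuity of \<open>phi\<close>\<close>

lemma phi_inv_duality_map:
  assumes uc: "uniformly_convex_space TYPE('a::banach)"
    and smooth: "uniformly_smooth_space TYPE('a)"
  shows "phi (z::'a) (inv duality_map f) = (norm z)\<^sup>2 - 2 * blinfun_apply f z + (norm f)\<^sup>2"
proof -
  have "duality_map (inv duality_map f :: 'a) = f"
    by (rule surj_f_inv_f[OF surj_duality_map[OF uc smooth]])
  then show ?thesis
    using norm_duality_map[OF smooth, of "inv duality_map f"] by (simp add: phi_def)
qed

text \<open>In the dual variable \<open>f\<close>, \<open>phi z (inv duality_map f)\<close> is an
  affine function plus the squared dual norm, hence convex.\<close>

lemma phi_inv_duality_map_convex_comb:
  fixes x y z :: "'a::banach"
  assumes uc: "uniformly_convex_space TYPE('a)" and smooth: "uniformly_smooth_space TYPE('a)"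
    and l: "0 \<le> l" "l \<le> 1"
  shows "phi z (inv duality_map (l *\<^sub>R duality_map x + (1 - l) *\<^sub>R duality_map y))
           \<le> l * phi z x + (1 - l) * phi z y"
proof -
  define f where "f = l *\<^sub>R duality_map x + (1 - l) *\<^sub>R duality_map y"
  have "blinfun_apply f z = l * blinfun_apply (duality_map x) z + (1 - l) * blinfun_apply (duality_map y) z"
    by (simp add: f_def blinfun.add_left blinfun.scaleR_left)
  moreover have "(norm f)\<^sup>2 \<le> l * (norm x)\<^sup>2 + (1 - l) * (norm y)\<^sup>2"
    using norm_power2_convex_comb[OF l, of "duality_map x" "duality_map y"]
    by (simp add: f_def norm_duality_map[OF smooth])
  ultimately have "phi z (inv duality_map f) \<le> l * phi z x + (1 - l) * phi z y"
    unfolding phi_inv_duality_map[OF uc smooth] phi_def[of z x] phi_def[of z y] by (simp add: algebra_simps)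
  then show ?thesis by (simp add: f_def)
qed

lemma phi_ge:
  fixes x y :: "'a::real_normed_vector"
  assumes smooth: "uniformly_smooth_space TYPE('a)"
  shows "(norm x - norm y)\<^sup>2 \<le> phi x y"
proof -
  have "blinfun_apply (duality_map y) x \<le> norm y * norm x"
    using norm_blinfun[of "duality_map y" x] norm_duality_map[OF smooth, of y] by simp
  then show ?thesis by (simp add: phi_def power2_eq_square algebra_simps)
qed

lemma phi_nonneg:
  fixes x y :: "'a::real_normed_vector"
  assumes smooth: "uniformly_smooth_space TYPE('a)"
  shows "0 \<le> phi x y"
  using phi_ge[OF smooth, of x y] by (smt (verit) zero_le_power2)

lemma phi_self:
  fixes x :: "'a::real_normed_vector"
  assumes smooth: "uniformly_smooth_space TYPE('a)"
  shows "phi x x = 0"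
  by (simp add: phi_def duality_map_self[OF smooth])

text \<open>Small \<open>phi\<close> forces nearly equal norms. If \<open>x\<close> and
  \<open>y\<close> were still far apart, their directions would be too; uniform convexity would then
  keep \<open>duality_map y\<close> at \<open>x\<close> well below \<open>norm x * norm y\<close>,
  making \<open>phi x y\<close> large.\<close>

lemma norm_diff_le_if_phi_small:
  assumes uc: "uniformly_convex_space TYPE('a::real_normed_vector)"
    and smooth: "uniformly_smooth_space TYPE('a)" and "e > 0"
  shows "\<exists>d>0. \<forall>x y::'a. norm x \<le> R \<longrightarrow> phi x y < d \<longrightarrow> norm (x - y) < e"
proof -
  define S where "S = max R 0 + 1"
  have "S > 0" by (simp add: S_def)
  define r where "r = e / 4"
  have "r > 0" using \<open>e > 0\<close> by (simp add: r_def)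
  have "e / (2 * S) > 0" using \<open>e > 0\<close> \<open>S > 0\<close> by simp
  then obtain d0 where "d0 > 0" and
      d0: "\<And>x y::'a. norm x = 1 \<Longrightarrow> norm y = 1 \<Longrightarrow> norm (x - y) \<ge> e / (2 * S) \<Longrightarrow>
            norm ((1/2) *\<^sub>R (x + y)) \<le> 1 - d0"
    using uc unfolding uniformly_convex_space_def by blast
  \<comment> \<open>The three bounds give, in turn, \<open>norm y \<le> S\<close>, norms within
    \<open>r / 2\<close> of each other, and the final contradiction.\<close>
  define d where "d = min 1 (min ((r/2)\<^sup>2) (2 * d0 * r\<^sup>2))"
  have "d > 0" using \<open>d0 > 0\<close> \<open>r > 0\<close> by (simp add: d_def)
  moreover have "norm (x - y) < e" if x: "norm x \<le> R" and xy: "phi x y < d" for x y :: 'a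
  proof (rule ccontr)
    assume far: "\<not> norm (x - y) < e"
    have sq: "(norm x - norm y)\<^sup>2 < 1\<^sup>2" "(norm x - norm y)\<^sup>2 < (r/2)\<^sup>2"
      using phi_ge[OF smooth, of x y] xy by (auto simp: d_def)
    have close: "\<bar>norm x - norm y\<bar> < 1" "\<bar>norm x - norm y\<bar> < r / 2"
      using abs_square_less_1[of "norm x - norm y"] sq
        power2_less_imp_less[of "\<bar>norm x - norm y\<bar>" "r/2"] \<open>r > 0\<close> by auto
    have yS: "norm y \<le> S" using x close by (simp add: S_def)
    have "norm (x - y) \<le> norm x + norm y" by (rule norm_triangle_ineq4)
    then have ry: "norm y > r" using far close \<open>e > 0\<close> unfolding r_def by linarith
    then have rx: "norm x > r / 2" using close by linarith
    define x' where "x' = (1 / norm x) *\<^sub>R x"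
    define y' where "y' = (1 / norm y) *\<^sub>R y"
    have n: "norm x' = 1" "norm y' = 1" using rx ry \<open>r > 0\<close> by (auto simp: x'_def y'_def)
    have "norm x *\<^sub>R x' = x" "norm y *\<^sub>R y' = y" using rx ry \<open>r > 0\<close> by (auto simp: x'_def y'_def)
    \<comment> \<open>Radial plus angular part: the radial one is below
      \<open>r / 2 = e / 8\<close>, so the angular one carries at least
      \<open>e / 2\<close>.\<close>
    then have "x - y = (norm x - norm y) *\<^sub>R x' + norm y *\<^sub>R (x' - y')"
      by (simp add: algebra_simps)
    then have "norm (x - y) \<le> \<bar>norm x - norm y\<bar> + norm y * norm (x' - y')"
      using norm_triangle_ineq[of "(norm x - norm y) *\<^sub>R x'" "norm y *\<^sub>R (x' - y')"] n by simp
    also have "\<dots> \<le> r / 2 + S * norm (x' - y')"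
      using close yS by (intro add_mono mult_right_mono) auto
    finally have "S * norm (x' - y') \<ge> e / 2" using far \<open>e > 0\<close> by (simp add: r_def)
    then have "norm (x' - y') \<ge> e / (2 * S)" using \<open>S > 0\<close> by (simp add: field_simps)
    then have h: "norm ((1/2) *\<^sub>R (x' + y')) \<le> 1 - d0" using d0 n by blast
    have "blinfun_apply (duality_map y) ((1/2) *\<^sub>R (x' + y')) \<le> norm y * norm ((1/2) *\<^sub>R (x' + y'))"
      using norm_blinfun[of "duality_map y" "(1/2) *\<^sub>R (x' + y')"] norm_duality_map[OF smooth, of y]
      by simp
    also have "\<dots> \<le> norm y * (1 - d0)" using h by (intro mult_left_mono) auto
    finally have "blinfun_apply (duality_map y) x' + blinfun_apply (duality_map y) y' \<le> 2 * norm y * (1 - d0)"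
      by (simp add: blinfun.scaleR_right blinfun.add_right)
    moreover have "blinfun_apply (duality_map y) y' = norm y"
      using ry \<open>r > 0\<close> duality_map_self[OF smooth, of y]
      by (simp add: y'_def blinfun.scaleR_right power2_eq_square)
    ultimately have "blinfun_apply (duality_map y) x' \<le> norm y * (1 - 2 * d0)"
      by (simp add: algebra_simps)
    then have "norm x * blinfun_apply (duality_map y) x' \<le> norm x * (norm y * (1 - 2 * d0))"
      by (intro mult_left_mono) auto
    moreover have "norm x * blinfun_apply (duality_map y) x' = blinfun_apply (duality_map y) x"
      using rx \<open>r > 0\<close> by (simp add: x'_def blinfun.scaleR_right)
    \<comment> \<open>\<open>phi x y\<close> is \<open>(norm x - norm y)\<^sup>2\<close> plus twice
      the gap between \<open>norm x * norm y\<close> and the pairing, and that gap is at least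
      \<open>2 * d0 * (norm x * norm y)\<close>.\<close>
    ultimately have "phi x y \<ge> (norm x - norm y)\<^sup>2 + 4 * d0 * (norm x * norm y)"
      by (simp add: phi_def power2_eq_square algebra_simps)
    moreover have "r / 2 * r \<le> norm x * norm y"
      using rx ry \<open>r > 0\<close> by (intro mult_mono) auto
    then have "4 * d0 * (r / 2 * r) \<le> 4 * d0 * (norm x * norm y)"
      using \<open>d0 > 0\<close> by (intro mult_left_mono) auto
    ultimately have "phi x y \<ge> (norm x - norm y)\<^sup>2 + 2 * d0 * r\<^sup>2"
      by (simp add: power2_eq_square)
    moreover have "(norm x - norm y)\<^sup>2 \<ge> 0" by simp
    ultimately have "phi x y \<ge> 2 * d0 * r\<^sup>2" by linarith
    with xy show False by (simp add: d_def)
  qed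
  ultimately show ?thesis by blast
qed

lemma phi_eq_0_iff:
  fixes x y :: "'a::real_normed_vector"
  assumes uc: "uniformly_convex_space TYPE('a)" and smooth: "uniformly_smooth_space TYPE('a)"
  shows "phi x y = 0 \<longleftrightarrow> x = y"
proof
  assume 0: "phi x y = 0"
  show "x = y"
  proof (rule ccontr)
    assume "x \<noteq> y"
    then have "norm (x - y) > 0" by simp
    from norm_diff_le_if_phi_small[OF uc smooth this, of "norm x"] 0 show False
      by (metis order_refl order_less_irrefl)
  qed
qed (simp add: phi_self[OF smooth])

lemma tendsto_phi:
  fixes x :: "'a::real_normed_vector"
  assumes "uniformly_smooth_space TYPE('a)" "X \<longlonglongrightarrow> x"
  shows "(\<lambda>n. phi z (X n)) \<longlonglongrightarrow> phi z x"
  unfolding phi_def by (intro tendsto_intros duality_map_weak_star_continuous assms)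

section \<open>Generalized projections\<close>

lemma bdd_below_phi:
  fixes K :: "'a::real_normed_vector set"
  assumes "uniformly_smooth_space TYPE('a)"
  shows "bdd_below ((\<lambda>v. phi v y) ` K)"
  using phi_nonneg[OF assms] by (intro bdd_belowI2) auto

lemma is_phi_minimizer_le:
  fixes K :: "'a::real_normed_vector set"
  assumes "uniformly_smooth_space TYPE('a)" "is_phi_minimizer K y x" "z \<in> K"
  shows "phi x y \<le> phi z y"
  using assms cINF_lower[OF bdd_below_phi[OF assms(1)], of z K y]
  by (simp add: is_phi_minimizer_def)

lemma is_phi_minimizerI:
  fixes K :: "'a::real_normed_vector set"
  assumes "x \<in> K" "\<And>z. z \<in> K \<Longrightarrow> phi x y \<le> phi z y"
  shows "is_phi_minimizer K y x"
  unfolding is_phi_minimizer_def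
proof
  have "Inf ((\<lambda>v. phi v y) ` K) = phi x y" by (rule cInf_eq_minimum) (use assms in auto)
  then show "phi x y = (INF v\<in>K. phi v y)" by simp
qed fact

text \<open>The first-order condition at the minimizer, \<open>(duality_map x - duality_map y) (z - x) \<ge> 0\<close>,
  combined with the three-point identity for \<open>phi\<close>.\<close>
lemma phi_minimizer_three_point:
  fixes K :: "'a::real_normed_vector set"
  assumes smooth: "uniformly_smooth_space TYPE('a)" and "convex K"
    and min: "is_phi_minimizer K y x" and z: "z \<in> K"
  shows "phi z x \<le> phi z y - phi x y"
proof -
  have "x \<in> K" using min by (simp add: is_phi_minimizer_def)
  have "blinfun_apply (duality_map y) (z - x) \<le> blinfun_apply (duality_map x) (z - x)"
  proof (rule field_le_epsilon)
    fix e :: real assume "e > 0"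
    obtain d where "d > 0" and
      d: "\<And>t. 0 < t \<Longrightarrow> t \<le> d \<Longrightarrow> sq_quot x t (z - x) \<le> blinfun_apply (duality_map x) (z - x) + e"
      using sq_quot_le_duality_map[OF smooth \<open>e > 0\<close>] by blast
    define t where "t = min d 1"
    have t: "t > 0" "t \<le> 1" "t \<le> d" using \<open>d > 0\<close> by (auto simp: t_def)
    have "x + t *\<^sub>R (z - x) = (1 - t) *\<^sub>R x + t *\<^sub>R z" by (simp add: algebra_simps)
    also have "\<dots> \<in> K" using \<open>convex K\<close> \<open>x \<in> K\<close> z t by (simp add: convex_alt)
    finally have "phi x y \<le> phi (x + t *\<^sub>R (z - x)) y" by (rule is_phi_minimizer_le[OF smooth min])
    then have "2 * (t * blinfun_apply (duality_map y) (z - x)) \<le> (norm (x + t *\<^sub>R (z - x)))\<^sup>2 - (norm x)\<^sup>2"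
      unfolding phi_def blinfun.add_right blinfun.scaleR_right by simp
    then have "blinfun_apply (duality_map y) (z - x) \<le> sq_quot x t (z - x)"
      using t by (simp add: sq_quot_def field_simps)
    with d[OF t(1,3)] show "blinfun_apply (duality_map y) (z - x) \<le> blinfun_apply (duality_map x) (z - x) + e"
      by linarith
  qed
  then show ?thesis
    by (simp add: phi_def blinfun.diff_right duality_map_self[OF smooth])
qed

text \<open>The three-point inequality applied to a second minimizer \<open>q\<close> gives
  \<open>phi q x \<le> 0\<close>.\<close>

lemma gen_proj_eqI:
  fixes K :: "'a::real_normed_vector set"
  assumes uc: "uniformly_convex_space TYPE('a)" and smooth: "uniformly_smooth_space TYPE('a)"
    and "convex K" and min: "is_phi_minimizer K y x"
  shows "gen_proj K y = x"
proof -
  have unique: "q = x" if q: "is_phi_minimizer K y q" for q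
  proof -
    have "q \<in> K" "x \<in> K" using q min by (simp_all add: is_phi_minimizer_def)
    then have "phi q x \<le> phi q y - phi x y" "phi q y \<le> phi x y"
      using phi_minimizer_three_point[OF smooth \<open>convex K\<close> min]
        is_phi_minimizer_le[OF smooth q] by auto
    then have "phi q x = 0" using phi_nonneg[OF smooth, of q x] by linarith
    then show ?thesis using phi_eq_0_iff[OF uc smooth] by simp
  qed
  show ?thesis unfolding gen_proj_def is_gen_proj_def
    by (rule the_equality) (use min unique in blast)+
qed

section \<open>Proximal distance, half-spaces and best proximity points\<close>

lemma dist_phi_le:
  fixes M N :: "'a::real_normed_vector set"
  assumes "uniformly_smooth_space TYPE('a)" "x \<in> M" "y \<in> N"
  shows "dist_phi M N \<le> phi x y"
  unfolding dist_phi_def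
  by (rule cInf_lower) (use assms phi_nonneg[OF assms(1)] in \<open>auto intro!: bdd_belowI[of _ 0]\<close>)

text \<open>A partner \<open>w\<close> of \<open>y\<close> attains the lower bound
  \<open>dist_phi M N\<close>, so it is the projection. This supplies the premise of suppressiveness
  for the projected iterates.\<close>

lemma phi_gen_proj_prox_right:
  fixes M N :: "'a::real_normed_vector set"
  assumes uc: "uniformly_convex_space TYPE('a)" and smooth: "uniformly_smooth_space TYPE('a)"
    and "convex M" and y: "y \<in> prox_right M N"
  shows "gen_proj M y \<in> M" "phi (gen_proj M y) y = dist_phi M N"
proof -
  obtain w where w: "w \<in> M" "phi w y = dist_phi M N" and "y \<in> N"
    using y by (auto simp: prox_right_def)
  then have "is_phi_minimizer M y w"
    using dist_phi_le[OF smooth] by (intro is_phi_minimizerI) auto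
  then have "gen_proj M y = w" by (rule gen_proj_eqI[OF uc smooth \<open>convex M\<close>])
  with w show "gen_proj M y \<in> M" "phi (gen_proj M y) y = dist_phi M N" by auto
qed

text \<open>The term \<open>(norm z)\<^sup>2\<close> cancels, leaving a half-space.\<close>

lemma convex_phi_le_phi:
  fixes K :: "'a::real_normed_vector set"
  assumes "convex K"
  shows "convex {z \<in> K. phi z x \<le> phi z y}"
proof -
  let ?f = "blinfun_apply (2 *\<^sub>R (duality_map y - duality_map x))"
  have "{z \<in> K. phi z x \<le> phi z y} = K \<inter> ?f -` {..(norm y)\<^sup>2 - (norm x)\<^sup>2}"
    by (auto simp: phi_def blinfun.scaleR_left blinfun.diff_left)
  moreover have "linear ?f" by (rule blinfun.bounded_linear_right[THEN bounded_linear.linear])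
  then have "convex (?f -` {..(norm y)\<^sup>2 - (norm x)\<^sup>2})" by (intro convex_linear_vimage) auto
  ultimately show ?thesis using assms by (simp add: convex_Int)
qed

lemma proximally_weakly_suppressiveE:
  assumes "proximally_weakly_suppressive M N T"
  obtains \<eta> :: "real \<Rightarrow> real"
  where "\<eta> \<in> {0..} \<rightarrow> {0..}" "continuous_on {0..} \<eta>" "\<And>t. t > 0 \<Longrightarrow> \<eta> t > 0"
    and "\<And>u1 u2 v1 v2. u1 \<in> M \<Longrightarrow> u2 \<in> M \<Longrightarrow> v1 \<in> M \<Longrightarrow> v2 \<in> M \<Longrightarrow>
           phi u1 (T v1) = dist_phi M N \<Longrightarrow> phi u2 (T v2) = dist_phi M N \<Longrightarrow>
           phi u1 u2 \<le> phi v1 v2 - \<eta> (phi v1 v2)"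
  using assms unfolding proximally_weakly_suppressive_def
  by (elim exE conjE) (rule that, assumption, assumption, simp, simp)

lemma best_prox_unique:
  fixes M N :: "'a::real_normed_vector set"
  assumes uc: "uniformly_convex_space TYPE('a)" and smooth: "uniformly_smooth_space TYPE('a)"
    and sup: "proximally_weakly_suppressive M N T"
    and "p \<in> best_prox M N T" "q \<in> best_prox M N T"
  shows "q = p"
proof -
  obtain \<eta> :: "real \<Rightarrow> real" where pos: "\<And>t. t > 0 \<Longrightarrow> \<eta> t > 0"
    and supp: "\<And>u1 u2 v1 v2. u1 \<in> M \<Longrightarrow> u2 \<in> M \<Longrightarrow> v1 \<in> M \<Longrightarrow> v2 \<in> M \<Longrightarrow>
           phi u1 (T v1) = dist_phi M N \<Longrightarrow> phi u2 (T v2) = dist_phi M N \<Longrightarrow>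
           phi u1 u2 \<le> phi v1 v2 - \<eta> (phi v1 v2)"
    by (rule proximally_weakly_suppressiveE[OF sup]) (rule that)
  \<comment> \<open>Suppressiveness with \<open>u1 = v1 = q\<close> and
    \<open>u2 = v2 = p\<close>.\<close>
  have "phi q p \<le> phi q p - \<eta> (phi q p)"
    using assms(4,5) by (intro supp) (auto simp: best_prox_def)
  then have "\<not> \<eta> (phi q p) > 0" by simp
  with pos have "\<not> phi q p > 0" by blast
  with phi_nonneg[OF smooth, of q p] have "phi q p = 0" by linarith
  then show ?thesis using phi_eq_0_iff[OF uc smooth] by simp
qed

section \<open>Strong convergence of the shrinking projection iteration\<close>

theorem theorem3p4:
  fixes M N :: "'a::banach set"
    and T :: "'a \<Rightarrow> 'a"
    and a :: real
    and \<alpha> :: "nat \<Rightarrow> real"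
    and u0 :: 'a
    and u v :: "nat \<Rightarrow> 'a"
    and H :: "nat \<Rightarrow> 'a set"
  assumes "uniformly_convex_space TYPE('a)"
    and "uniformly_smooth_space TYPE('a)"
    and "M \<noteq> {}" and "closed M" and "convex M"
    and "N \<noteq> {}" and "closed N" and "convex N"
    and "convex (prox_left M N)"
    and "T \<in> M \<rightarrow> N"
    and "proximally_weakly_suppressive M N T"
    and "T ` prox_left M N \<subseteq> prox_right M N"
    and "best_prox M N T \<noteq> {}"
    and "u0 \<in> prox_left M N"
    and "0 \<le> a" and "a < 1"
    and "\<And>n. n \<ge> 1 \<Longrightarrow> 0 \<le> \<alpha> n \<and> \<alpha> n \<le> a"
    and "is_gen_proj (prox_left M N) u0 (u 1)"
    and "H 1 = prox_left M N"
    and "\<And>n. n \<ge> 1 \<Longrightarrow>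
           v n = inv duality_map (\<alpha> n *\<^sub>R duality_map (u n)
                   + (1 - \<alpha> n) *\<^sub>R duality_map (gen_proj M (T (u n))))"
    and "\<And>n. n \<ge> 1 \<Longrightarrow> H (n + 1) = {z \<in> H n. phi z (v n) \<le> phi z (u n)}"
    and "\<And>n. n \<ge> 1 \<Longrightarrow> is_gen_proj (H (n + 1)) u0 (u (n + 1))"
    and "phi_proximal_property M N T"
  shows "\<exists>ustar. is_gen_proj (best_prox M N T) u0 ustar \<and> u \<longlonglongrightarrow> ustar"
proof -
  note uc = assms(1) and smooth = assms(2)
  obtain p where p: "p \<in> best_prox M N T" using assms(13) by blast
  have best: "best_prox M N T = {p}"
    using p best_prox_unique[OF uc smooth assms(11)] by blast
  have pM: "p \<in> M" and pT: "phi p (T p) = dist_phi M N" using p by (auto simp: best_prox_def)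
  have "T p \<in> N" using assms(10) pM by auto
  with pM pT have pM0: "p \<in> prox_left M N" by (auto simp: prox_left_def)
  obtain \<eta> :: "real \<Rightarrow> real" where \<eta>: "\<eta> \<in> {0..} \<rightarrow> {0..}" "continuous_on {0..} \<eta>" "\<And>t. t > 0 \<Longrightarrow> \<eta> t > 0"
    and sup: "\<And>u1 u2 v1 v2. u1 \<in> M \<Longrightarrow> u2 \<in> M \<Longrightarrow> v1 \<in> M \<Longrightarrow> v2 \<in> M \<Longrightarrow>
           phi u1 (T v1) = dist_phi M N \<Longrightarrow> phi u2 (T v2) = dist_phi M N \<Longrightarrow>
           phi u1 u2 \<le> phi v1 v2 - \<eta> (phi v1 v2)"
    by (rule proximally_weakly_suppressiveE[OF assms(11)]) (rule that)
  have min: "is_phi_minimizer (H n) u0 (u n)" if "n \<ge> 1" for n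
    using that assms(18,19) assms(22)[of "n - 1"]
    by (cases "n = 1") (auto simp: is_gen_proj_def)
  then have uH: "u n \<in> H n" if "n \<ge> 1" for n using that by (simp add: is_phi_minimizer_def)
  have H: "convex (H n) \<and> H n \<subseteq> prox_left M N" if "n \<ge> 1" for n
    using that
  proof (induction n rule: dec_induct)
    case base
    then show ?case using assms(9,19) by simp
  next
    case (step n)
    then show ?case using assms(21)[of n] convex_phi_le_phi[of "H n" "v n" "u n"] by auto
  qed
  have Hanti: "H m \<subseteq> H n" if "n \<ge> 1" "n \<le> m" for m n
    using that(2)
  proof (induction m rule: dec_induct)
    case (step m)
    then show ?case using assms(21)[of m] that(1) by auto
  qed simp
  \<comment> \<open>Suppressiveness for the pairs \<open>(p, p)\<close> and \<open>(?w, u n)\<close>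
    lowers \<open>phi p ?w\<close>; convexity in the dual variable passes this on to
    \<open>v n\<close>, and \<open>\<alpha> n \<le> a\<close> retains at least the share
    \<open>1 - a\<close> of the drop.\<close>
  have decrease: "phi p (v n) \<le> phi p (u n) - (1 - a) * \<eta> (phi p (u n))" if n: "n \<ge> 1" for n
  proof -
    let ?w = "gen_proj M (T (u n))" and ?b = "\<eta> (phi p (u n))"
    have u: "u n \<in> prox_left M N" using uH[OF n] H[OF n] by auto
    then have "T (u n) \<in> prox_right M N" using assms(12) by auto
    note w = phi_gen_proj_prox_right[OF uc smooth assms(5) this]
    have "u n \<in> M" using u by (simp add: prox_left_def)
    then have pw: "phi p ?w \<le> phi p (u n) - ?b" by (intro sup pM w pT)
    have \<alpha>: "0 \<le> \<alpha> n" "\<alpha> n \<le> a" using assms(17)[OF n] by auto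
    have "phi p (v n) \<le> \<alpha> n * phi p (u n) + (1 - \<alpha> n) * phi p ?w"
      unfolding assms(20)[OF n] using \<alpha> assms(16) by (intro phi_inv_duality_map_convex_comb uc smooth) auto
    also have "\<dots> \<le> \<alpha> n * phi p (u n) + (1 - \<alpha> n) * (phi p (u n) - ?b)"
      using \<alpha> assms(16) by (intro add_left_mono mult_left_mono pw) auto
    also have "\<dots> = phi p (u n) - (1 - \<alpha> n) * ?b" by (simp add: algebra_simps)
    also have "\<dots> \<le> phi p (u n) - (1 - a) * ?b"
      using \<alpha> \<eta>(1) phi_nonneg[OF smooth, of p "u n"] by (intro diff_left_mono mult_right_mono) auto
    finally show ?thesis .
  qed
  have pH: "p \<in> H n" if "n \<ge> 1" for n
    using that
  proof (induction n rule: dec_induct)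
    case base
    then show ?case using pM0 assms(19) by simp
  next
    case (step n)
    have "0 \<le> (1 - a) * \<eta> (phi p (u n))"
      using assms(16) \<eta>(1) phi_nonneg[OF smooth, of p "u n"] by (intro mult_nonneg_nonneg) auto
    with decrease[OF step.hyps(1)] have "phi p (v n) \<le> phi p (u n)" by linarith
    with step show ?case using assms(21)[of n] by simp
  qed
  \<comment> \<open>The shift starts at index 1; \<open>u 0\<close> is unconstrained.\<close>
  define c where "c n = phi (u (Suc n)) u0" for n
  \<comment> \<open>\<open>u (Suc m)\<close> lies in \<open>H (Suc n)\<close>, over which
    \<open>u (Suc n)\<close> is the minimizer.\<close>
  have tri: "phi (u (Suc m)) (u (Suc n)) \<le> c m - c n" if "n \<le> m" for m n
    unfolding c_def using H[of "Suc n"] uH[of "Suc m"] Hanti[of "Suc n" "Suc m"] that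
    by (intro phi_minimizer_three_point[OF smooth _ min]) auto
  have "incseq c"
    unfolding incseq_def using tri phi_nonneg[OF smooth] by (meson diff_ge_0_iff_ge order_trans)
  \<comment> \<open>\<open>p\<close> competes in every minimization, which bounds \<open>c\<close>
    and, through \<open>phi_ge\<close>, the iterates.\<close>
  have cle: "c n \<le> phi p u0" for n
    unfolding c_def using pH[of "Suc n"] by (intro is_phi_minimizer_le[OF smooth min]) auto
  obtain l where l: "c \<longlonglongrightarrow> l" using incseq_convergent[OF \<open>incseq c\<close>] cle by metis
  have bound: "norm (u (Suc n)) \<le> norm u0 + sqrt (phi p u0)" for n
  proof -
    have "(norm (u (Suc n)) - norm u0)\<^sup>2 \<le> phi p u0"
      using phi_ge[OF smooth, of "u (Suc n)" u0] cle[of n] by (simp add: c_def)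
    then have "norm (u (Suc n)) - norm u0 \<le> sqrt (phi p u0)" by (rule real_le_rsqrt)
    then show ?thesis by simp
  qed
  have "Cauchy (\<lambda>n. u (Suc n))"
  proof (rule metric_CauchyI)
    fix e :: real assume "e > 0"
    obtain d where "d > 0" and d: "\<And>x y::'a. norm x \<le> norm u0 + sqrt (phi p u0) \<Longrightarrow> phi x y < d \<Longrightarrow> norm (x - y) < e"
      using norm_diff_le_if_phi_small[OF uc smooth \<open>e > 0\<close>] by blast
    obtain k where k: "\<And>m n. m \<ge> k \<Longrightarrow> n \<ge> k \<Longrightarrow> dist (c m) (c n) < d"
      using LIMSEQ_imp_Cauchy[OF l] \<open>d > 0\<close> unfolding Cauchy_def by blast
    \<comment> \<open>\<open>phi\<close> is not symmetric, so the later iterate must be its first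
      argument; the other order follows from symmetry of \<open>dist\<close>.\<close>
    have *: "dist (u (Suc m)) (u (Suc n)) < e" if "n \<ge> k" "n \<le> m" for m n
      unfolding dist_norm using tri[OF that(2)] k[of m n] that by (intro d bound) (auto simp: dist_real_def)
    show "\<exists>k. \<forall>m\<ge>k. \<forall>n\<ge>k. dist (u (Suc m)) (u (Suc n)) < e"
      using * by (metis dist_commute nle_le)
  qed
  then obtain x where x: "(\<lambda>n. u (Suc n)) \<longlonglongrightarrow> x" using Cauchy_convergent_iff convergent_def by blast
  \<comment> \<open>Membership of the next iterate in the new set compares its \<open>phi\<close> to
    \<open>v (Suc n)\<close> with its \<open>phi\<close> to \<open>u (Suc n)\<close>, which is at
    most an increment of \<open>c\<close> and so tends to 0.\<close>
  have "(\<lambda>n. u (Suc (Suc n)) - v (Suc n)) \<longlonglongrightarrow> 0"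
  proof (rule LIMSEQ_I)
    fix e :: real assume "e > 0"
    obtain d where "d > 0" and d: "\<And>x y::'a. norm x \<le> norm u0 + sqrt (phi p u0) \<Longrightarrow> phi x y < d \<Longrightarrow> norm (x - y) < e"
      using norm_diff_le_if_phi_small[OF uc smooth \<open>e > 0\<close>] by blast
    have "(\<lambda>n. c (Suc n) - c n) \<longlonglongrightarrow> l - l" by (intro tendsto_diff l LIMSEQ_Suc)
    then have "\<forall>\<^sub>F n in sequentially. c (Suc n) - c n < d"
      using \<open>d > 0\<close> by (intro order_tendstoD(2)) auto
    then have "\<forall>\<^sub>F n in sequentially. norm (u (Suc (Suc n)) - v (Suc n) - 0) < e"
    proof eventually_elim
      case (elim n)
      have "u (Suc (Suc n)) \<in> H (Suc n + 1)" using uH[of "Suc (Suc n)"] by simp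
      then have "phi (u (Suc (Suc n))) (v (Suc n)) \<le> phi (u (Suc (Suc n))) (u (Suc n))"
        using assms(21)[of "Suc n"] by simp
      also have "\<dots> \<le> c (Suc n) - c n" by (intro tri) simp
      finally show ?case using elim d[OF bound] by simp
    qed
    then show "\<exists>k. \<forall>n\<ge>k. norm (u (Suc (Suc n)) - v (Suc n) - 0) < e"
      by (simp add: eventually_sequentially)
  qed
  then have "(\<lambda>n. u (Suc (Suc n)) - (u (Suc (Suc n)) - v (Suc n))) \<longlonglongrightarrow> x - 0"
    by (intro tendsto_diff LIMSEQ_Suc[OF x])
  then have v: "(\<lambda>n. v (Suc n)) \<longlonglongrightarrow> x" by simp
  note pu = tendsto_phi[OF smooth x, of p] and pv = tendsto_phi[OF smooth v, of p]
  \<comment> \<open>Nonnegativity of \<open>phi\<close> keeps the arguments and their limit in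
    \<open>{0..}\<close>, where \<open>\<eta>\<close> is continuous.\<close>
  have "(\<lambda>n. \<eta> (phi p (u (Suc n)))) \<longlonglongrightarrow> \<eta> (phi p x)"
    using phi_nonneg[OF smooth] by (intro continuous_on_tendsto_compose[OF \<eta>(2) pu]) auto
  then have "(\<lambda>n. phi p (u (Suc n)) - (1 - a) * \<eta> (phi p (u (Suc n)))) \<longlonglongrightarrow>
      phi p x - (1 - a) * \<eta> (phi p x)"
    by (intro tendsto_intros pu)
  then have "phi p x \<le> phi p x - (1 - a) * \<eta> (phi p x)"
    using decrease by (intro LIMSEQ_le[OF pv]) auto
  then have "\<eta> (phi p x) \<le> 0" using assms(16) by (simp add: mult_le_0_iff)
  with \<eta>(3) phi_nonneg[OF smooth, of p x] have "phi p x = 0"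
    by (metis less_eq_real_def not_le)
  then have "x = p" using phi_eq_0_iff[OF uc smooth] by simp
  with x have "u \<longlonglongrightarrow> p" by (simp add: filterlim_sequentially_Suc)
  moreover have "is_gen_proj {p} u0 p" by (simp add: is_gen_proj_def is_phi_minimizer_def)
  ultimately show ?thesis unfolding best by blast
qed

end
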